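(* Let $m,n$ be positive integers. For every matrix $(a_{ij})\in\mathbb{R}^{m\times n}$ there exists a unique polynomial $p\in{}_{1}^{m}\Pi_{mn-1}^{2}$ such that $p(i,j)=a_{ij}$ for all $(i,j)\in\{1,\ldots,m\}\times\{1,\ldots,n\}$, and it is given by $$p(x,y)=\sum_{k=0}^{mn-1}\binom{(x+my)-(m+1)}{k}\Delta^k\widetilde a_1,$$ where $\widetilde a_1,\widetilde a_2,\ldots,\widetilde a_{mn}$ is the sequence defined by $\widetilde a_{i+(j-1)m}=a_{ij}$ for $i=1,\ldots,m$ and $j=1,\ldots,n$, and $\Delta^k\widetilde a_1$ is the $k$th Newton forward difference of $\widetilde a_1$ for this sequence.
   Context: ${}_{1}^{m}\Pi_{mn-1}^{2}$ denotes the space of all bivariate real polynomials of the form $p(x,y)=\sum_{k=0}^{mn-1}\lambda_k(x+my)^k$ with $\lambda_k\in\mathbb{R}$. Forward differences: $\Delta^0\widetilde a_l=\widetilde a_l$ and $\Delta^{k}\widetilde a_l=\Delta^{k-1}\widetilde a_{l+1}-\Delta^{k-1}\widetilde a_l$. For a polynomial argument $z$ and integer $k\ge0$, $\binom{z}{k}=\frac{z(z-1)\cdots(z-k+1)}{k!}$, with $\binom{z}{0}=1$. *)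

theory Defs
  imports "HOL-Computational_Algebra.Computational_Algebra"
begin

text \<open>
  Bivariate real polynomials are modelled as \<^typ>\<open>real poly poly\<close>: the inner indeterminate
  is \<open>x\<close>, the outer one is \<open>y\<close>.
\<close>

type_synonym bipoly = "real poly poly"

definition bconst :: "real \<Rightarrow> bipoly" where
  "bconst c = [:[:c:]:]"

definition bX :: bipoly where
  "bX = [:[:0, 1:]:]"

definition bY :: bipoly where
  "bY = [:0, 1:]"

definition beval :: "bipoly \<Rightarrow> real \<Rightarrow> real \<Rightarrow> real" where
  "beval p x y = poly (poly p [:y:]) x"

lemma beval_simps [simp]:
  "beval (bconst c) x y = c"
  "beval bX x y = x"
  "beval bY x y = y"
  "beval 0 x y = 0"
  "beval 1 x y = 1"
  "beval (p + q) x y = beval p x y + beval q x y"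
  "beval (p - q) x y = beval p x y - beval q x y"
  "beval (p * q) x y = beval p x y * beval q x y"
  "beval (p ^ k) x y = beval p x y ^ k"
  by (simp_all add: beval_def bconst_def bX_def bY_def)

text \<open>The space ${}_{1}^{m}\Pi_{mn-1}^{2}$.\<close>

definition ridge_space :: "nat \<Rightarrow> nat \<Rightarrow> bipoly set" where
  "ridge_space m n =
     {(\<Sum>k=0..m * n - 1. bconst (c k) * (bX + of_nat m * bY) ^ k) | c :: nat \<Rightarrow> real. True}"

fun fwd_diff :: "nat \<Rightarrow> (nat \<Rightarrow> real) \<Rightarrow> nat \<Rightarrow> real" where
  "fwd_diff 0 s l = s l"
| "fwd_diff (Suc k) s l = fwd_diff k s (l + 1) - fwd_diff k s l"

text \<open>
  The library's \<^const>\<open>gbinomial\<close> is constrained to fields of characteristic 0, hence is not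
  available on \<^typ>\<open>bipoly\<close>; under evaluation it agrees with the following.
\<close>

definition bbinom :: "bipoly \<Rightarrow> nat \<Rightarrow> bipoly" where
  "bbinom z k = bconst (1 / fact k) * (\<Prod>i = 0..<k. z - of_nat i)"

lemma beval_of_nat [simp]: "beval (of_nat k) x y = real k"
  by (induction k) simp_all

lemma beval_prod: "beval (\<Prod>i = 0..<(k::nat). f i) x y = (\<Prod>i = 0..<k. beval (f i) x y)"
  by (induction k) simp_all

lemma beval_bbinom: "beval (bbinom z k) x y = beval z x y gchoose k"
  by (simp add: bbinom_def beval_prod gbinomial_prod_rev)

end

theory Submission
  imports Defs
begin

text \<open>
  An element of the space is a univariate polynomial of degree less than \<open>m n\<close> in \<open>x + m y\<close>, and
  \<open>(i, j) \<mapsto> i + m j\<close> enumerates the grid bijectively by \<open>m + 1, \<dots>, m + m n\<close>. The problem is thus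
  univariate interpolation at consecutive integers, solved by Newton's forward difference formula.
\<close>

lemma beval_sum: "beval (sum f A) x y = (\<Sum>i\<in>A. beval (f i) x y)"
  by (induction A rule: infinite_finite_induct) simp_all

text \<open>A nonzero \<open>p - q\<close>, viewed as a polynomial in the outer indeterminate, has
  only finitely many roots in the integral domain \<open>real poly\<close>. But every constant
  \<open>[:y:]\<close> is a root: its value there is a polynomial in x that vanishes at all
  reals.\<close>

lemma bipoly_eqI:
  assumes "\<And>x y. beval p x y = beval q x y"
  shows "p = q"
proof (rule ccontr)
  assume "p \<noteq> q"
  then have "finite {z. poly (p - q) z = 0}"
    by (intro poly_roots_finite) simp
  moreover have "poly (p - q) [:y:] = 0" for y
    using assms by (simp add: beval_def poly_eq_poly_eq_iff[symmetric] fun_eq_iff)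
  then have "range (\<lambda>y. [:y:]) \<subseteq> {z. poly (p - q) z = 0}"
    by auto
  ultimately have "finite (range (\<lambda>y::real. [:y:]))"
    by (rule rev_finite_subset)
  then show False
    using infinite_UNIV_char_0[where 'a = real] finite_imageD[of "\<lambda>y::real. [:y:]" UNIV]
    by (simp add: inj_def)
qed

lemma ridge_space_iff:
  assumes "m * n > 0"
  shows "p \<in> ridge_space m n \<longleftrightarrow>
    (\<exists>q. degree q < m * n \<and> (\<forall>x y. beval p x y = poly q (x + real m * y)))"
proof
  assume "p \<in> ridge_space m n"
  then obtain c where p: "p = (\<Sum>k=0..m * n - 1. bconst (c k) * (bX + of_nat m * bY) ^ k)"
    by (auto simp: ridge_space_def)
  let ?q = "\<Sum>k=0..m * n - 1. monom (c k) k"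
  have "degree ?q \<le> m * n - 1"
    by (intro degree_sum_le) (auto intro: order.trans[OF degree_monom_le])
  then have "degree ?q < m * n"
    using assms by linarith
  moreover have "beval p x y = poly ?q (x + real m * y)" for x y
    by (simp add: p beval_sum poly_sum poly_monom)
  ultimately show "\<exists>q. degree q < m * n \<and> (\<forall>x y. beval p x y = poly q (x + real m * y))"
    by blast
next
  assume "\<exists>q. degree q < m * n \<and> (\<forall>x y. beval p x y = poly q (x + real m * y))"
  then obtain q where q: "degree q < m * n" "\<And>x y. beval p x y = poly q (x + real m * y)"
    by blast
  \<comment> \<open>\<open>poly_altdef\<close> sums only up to \<open>degree q\<close>; zero
    coefficients pad the sum to the fixed range.\<close>
  have "poly q z = (\<Sum>k=0..m * n - 1. coeff q k * z ^ k)" for z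
    unfolding poly_altdef using q(1)
    by (intro sum.mono_neutral_left) (auto simp: coeff_eq_0)
  then have "p = (\<Sum>k=0..m * n - 1. bconst (coeff q k) * (bX + of_nat m * bY) ^ k)"
    by (intro bipoly_eqI) (simp add: beval_sum q(2))
  then show "p \<in> ridge_space m n"
    by (auto simp: ridge_space_def)
qed

text \<open>Division with remainder by m inverts the enumeration, so each of the m n consecutive
  nodes comes from a grid point. The offset m + 1 is the value of x + m y at (1, 1).\<close>

lemma grid_point:
  fixes m n t :: nat
  assumes "t < m * n"
  shows "t mod m + 1 \<in> {1..m}" and "t div m + 1 \<in> {1..n}"
    and "real (t mod m + 1) + real m * real (t div m + 1) = real (m + 1 + t)"
proof -
  have "m > 0"
    using assms by (cases m) auto
  then show "t mod m + 1 \<in> {1..m}"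
    by (simp add: Suc_leI)
  show "t div m + 1 \<in> {1..n}"
    using assms by (simp add: Suc_leI less_mult_imp_div_less mult.commute)
  have "real (t mod m) + real m * real (t div m) = real t"
    by (metis mod_mult_div_eq of_nat_add of_nat_mult)
  then show "real (t mod m + 1) + real m * real (t div m + 1) = real (m + 1 + t)"
    by (simp add: algebra_simps)
qed

text \<open>The underlying univariate polynomials have degree below m n and agree at m n distinct
  nodes, hence coincide.\<close>

lemma ridge_space_eqI:
  assumes "m * n > 0" and "p \<in> ridge_space m n" and "p' \<in> ridge_space m n"
    and agree: "\<forall>i\<in>{1..m}. \<forall>j\<in>{1..n}. beval p (real i) (real j) = beval p' (real i) (real j)"
  shows "p = p'"
proof -
  obtain q where q: "degree q < m * n" "\<And>x y. beval p x y = poly q (x + real m * y)"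
    using assms ridge_space_iff by blast
  obtain q' where q': "degree q' < m * n" "\<And>x y. beval p' x y = poly q' (x + real m * y)"
    using assms ridge_space_iff by blast
  let ?A = "(\<lambda>t. real (m + 1 + t)) ` {..<m * n}"
  have "q = q'"
  proof (rule poly_eqI_degree[of ?A])
    show "poly q x = poly q' x" if "x \<in> ?A" for x
    proof -
      obtain t where t: "t < m * n" "x = real (m + 1 + t)"
        using \<open>x \<in> ?A\<close> by blast
      show ?thesis
        using agree grid_point[OF t(1)] q(2) q'(2) t(2) by metis
    qed
    have "card ?A = m * n"
      by (subst card_image) (auto simp: inj_on_def)
    then show "card ?A > degree q" "card ?A > degree q'"
      using q(1) q'(1) by simp_all
  qed
  then show ?thesis
    by (intro bipoly_eqI) (simp add: q(2) q'(2))
qed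

text \<open>The shift operator is 1 + \<Delta>, and this is its t-th power expanded binomially. In
  the inductive step the hypothesis is used at \<open>Suc l\<close>, and Pascal's rule recombines
  the two resulting sums.\<close>

lemma newton_forward_difference:
  "s (l + t) = (\<Sum>k\<le>t. real (t choose k) * fwd_diff k s l)"
proof (induction t arbitrary: l)
  case (Suc t)
  have shift: "fwd_diff k s (Suc l) = fwd_diff k s l + fwd_diff (Suc k) s l" for k
    by simp
  have "s (l + Suc t) = (\<Sum>k\<le>t. real (t choose k) * fwd_diff k s (Suc l))"
    using Suc.IH[of "Suc l"] by simp
  also have "\<dots> = (\<Sum>k\<le>t. real (t choose k) * fwd_diff k s l)
      + (\<Sum>k\<le>t. real (t choose k) * fwd_diff (Suc k) s l)"
    by (simp only: shift distrib_left sum.distrib)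
  \<comment> \<open>The added term is zero, as \<open>t choose Suc t\<close> vanishes. With it,
    splitting off k = 0 leaves a sum over the same range as the other one, ready for Pascal's
    rule.\<close>
  also have "(\<Sum>k\<le>t. real (t choose k) * fwd_diff k s l)
      = (\<Sum>k\<le>Suc t. real (t choose k) * fwd_diff k s l)"
    by simp
  also have "\<dots> = fwd_diff 0 s l + (\<Sum>k\<le>t. real (t choose Suc k) * fwd_diff (Suc k) s l)"
    by (subst sum.atMost_Suc_shift) simp
  also have "\<dots> + (\<Sum>k\<le>t. real (t choose k) * fwd_diff (Suc k) s l)
      = fwd_diff 0 s l + (\<Sum>k\<le>t. real (Suc t choose Suc k) * fwd_diff (Suc k) s l)"
    by (simp add: sum.distrib[symmetric] algebra_simps del: fwd_diff.simps)
  also have "\<dots> = (\<Sum>k\<le>Suc t. real (Suc t choose k) * fwd_diff k s l)"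
    by (subst sum.atMost_Suc_shift) simp
  finally show ?case .
qed simp

definition newton_ridge :: "nat \<Rightarrow> nat \<Rightarrow> (nat \<Rightarrow> real) \<Rightarrow> bipoly" where
  "newton_ridge m n s = (\<Sum>k=0..m * n - 1.
     bbinom ((bX + of_nat m * bY) - of_nat (m + 1)) k * bconst (fwd_diff k s 1))"

lemma beval_newton_ridge:
  "beval (newton_ridge m n s) x y =
    (\<Sum>k=0..m * n - 1. ((x + real m * y - real (m + 1)) gchoose k) * fwd_diff k s 1)"
  by (simp add: newton_ridge_def beval_sum beval_bbinom)

text \<open>Each binomial is, up to a scalar, a product of k linear factors in the single variable x
  + m y, so its degree there is at most k.\<close>

lemma newton_ridge_in_ridge_space:
  assumes "m * n > 0"
  shows "newton_ridge m n s \<in> ridge_space m n"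
proof -
  \<comment> \<open>As a function of z, \<open>?b k\<close> is k! times the binomial coefficient of
    z - (m + 1) over k.\<close>
  let ?b = "\<lambda>k. \<Prod>i=0..<k. [:- real (m + 1) - real i, 1:]"
  let ?q = "\<Sum>k=0..m * n - 1. smult (fwd_diff k s 1 / fact k) (?b k)"
  have "degree (?b k) \<le> k" for k
    using degree_prod_sum_le[of "{0..<k}" "\<lambda>i. [:- real (m + 1) - real i, 1:]"] by simp
  then have "degree ?q \<le> m * n - 1"
    by (intro degree_sum_le) (auto intro: order.trans[OF degree_smult_le] order.trans)
  then have "degree ?q < m * n"
    using assms by linarith
  moreover have "beval (newton_ridge m n s) x y = poly ?q (x + real m * y)" for x y
    by (simp add: beval_newton_ridge poly_sum poly_prod gbinomial_prod_rev algebra_simps)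
  ultimately show ?thesis
    using ridge_space_iff[OF assms] by blast
qed

text \<open>At a grid point the binomial argument is a natural number t < m n. The terms with k > t
  vanish, and what remains is Newton's formula started at index 1.\<close>

lemma newton_ridge_interpolates:
  assumes "i \<in> {1..m}" and "j \<in> {1..n}"
  shows "beval (newton_ridge m n s) (real i) (real j) = s (i + (j - 1) * m)"
proof -
  \<comment> \<open>The zero-based position of (i, j) in the enumeration; the sequence itself is
    indexed from 1.\<close>
  define t where "t = (i - 1) + (j - 1) * m"
  have arg: "real i + real m * real j - real (m + 1) = real t"
    using assms by (cases i; cases j) (auto simp: t_def algebra_simps)
  have "t < m + (j - 1) * m"
    using assms by (auto simp: t_def)
  also have "\<dots> = j * m"
    using assms by (cases j) auto
  also have "\<dots> \<le> m * n"
    using assms by (simp add: mult.commute)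
  finally have "t < m * n" .
  have "beval (newton_ridge m n s) (real i) (real j)
      = (\<Sum>k=0..m * n - 1. real (t choose k) * fwd_diff k s 1)"
    by (simp only: beval_newton_ridge arg binomial_gbinomial)
  also have "\<dots> = (\<Sum>k\<le>t. real (t choose k) * fwd_diff k s 1)"
    using \<open>t < m * n\<close> by (intro sum.mono_neutral_right) (auto simp: binomial_eq_0)
  also have "\<dots> = s (1 + t)"
    by (rule newton_forward_difference[symmetric])
  also have "1 + t = i + (j - 1) * m"
    using assms by (simp add: t_def)
  finally show ?thesis .
qed

theorem corollary3p16:
  fixes m n :: nat and a :: "nat \<Rightarrow> nat \<Rightarrow> real"
  assumes "m > 0" and "n > 0"
  shows "(\<exists>!p. p \<in> ridge_space m n \<and>
            (\<forall>i\<in>{1..m}. \<forall>j\<in>{1..n}. beval p (real i) (real j) = a i j)) \<and>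
         (\<forall>p s. p \<in> ridge_space m n \<longrightarrow>
            (\<forall>i\<in>{1..m}. \<forall>j\<in>{1..n}. beval p (real i) (real j) = a i j) \<longrightarrow>
            (\<forall>i\<in>{1..m}. \<forall>j\<in>{1..n}. s (i + (j - 1) * m) = a i j) \<longrightarrow>
            p = (\<Sum>k=0..m * n - 1.
                   bbinom ((bX + of_nat m * bY) - of_nat (m + 1)) k * bconst (fwd_diff k s 1)))"
proof -
  have mn: "m * n > 0"
    using assms by simp
  let ?interp = "\<lambda>p. p \<in> ridge_space m n \<and>
    (\<forall>i\<in>{1..m}. \<forall>j\<in>{1..n}. beval p (real i) (real j) = a i j)"
  have unique: "p = p'" if "?interp p" "?interp p'" for p p'
    using that ridge_space_eqI[OF mn] by simp
  have newton: "?interp (newton_ridge m n s)"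
    if "\<forall>i\<in>{1..m}. \<forall>j\<in>{1..n}. s (i + (j - 1) * m) = a i j" for s
    using that newton_ridge_in_ridge_space[OF mn] newton_ridge_interpolates by simp
  \<comment> \<open>Existence needs one concrete sequence with the prescribed values; the shifts by
    1 reconcile one-based indices with \<open>mod\<close> and \<open>div\<close>.\<close>
  define s where "s l = a ((l - 1) mod m + 1) ((l - 1) div m + 1)" for l
  have "s (i + (j - 1) * m) = a i j" if "i \<in> {1..m}" "j \<in> {1..n}" for i j
  proof -
    have l: "i + (j - 1) * m - 1 = (i - 1) + (j - 1) * m" and "i - 1 < m"
      using that by auto
    then have "(i + (j - 1) * m - 1) mod m = i - 1" "(i + (j - 1) * m - 1) div m = j - 1"
      unfolding l by simp_all
    then show ?thesis
      using that by (simp add: s_def)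
  qed
  then have "\<exists>!p. ?interp p"
    using newton[of s] unique by blast
  \<comment> \<open>Here \<open>s\<close> is any sequence matching the matrix, with arbitrary values
    outside 1, ..., m n: its Newton polynomial interpolates too, so uniqueness identifies it with
    \<open>p\<close>.\<close>
  moreover have "p = newton_ridge m n s"
    if "?interp p" "\<forall>i\<in>{1..m}. \<forall>j\<in>{1..n}. s (i + (j - 1) * m) = a i j" for p s
    using unique newton that by blast
  ultimately show ?thesis
    unfolding newton_ridge_def by blast
qed

end
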